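(* Let $x=x(s)$ be a regular curve in $\mathbb{E}^4$, parametrized by arclength $s$, with Frenet frame $V_1,V_2,V_3,V_4$ and nonzero Frenet curvatures $\kappa_1,\kappa_2,\kappa_3$. Let $\overline{x}=x+\lambda_1V_1+\lambda_2V_2$ be an involute of order $2$ of $x$. Put $\phi=\lambda_2\kappa_2$, $$K=\kappa_1\kappa_2\phi,\quad L=2\kappa_2\phi'+\kappa_2'\phi,\quad N=2\kappa_3\phi'+\kappa_3'\phi,$$ $$W=\sqrt{K^2(\kappa_2^2+\kappa_3^2)+(\kappa_2N-\kappa_3L)^2}=|\phi|\sqrt{\kappa_1^2\kappa_2^2(\kappa_2^2+\kappa_3^2)+(\kappa_2\kappa_3'-\kappa_3\kappa_2')^2}.$$ Then the Frenet $4$-frame $\overline{V}_1,\overline{V}_2,\overline{V}_3,\overline{V}_4$ and the Frenet curvatures $\overline{\kappa}_1,\overline{\kappa}_2,\overline{\kappa}_3$ of $\overline{x}$ are given by $$\overline{V}_1=V_3,\qquad \overline{V}_2=\frac{-\kappa_2V_2+\kappa_3V_4}{\sqrt{\kappa_2^2+\kappa_3^2}},$$ $$\overline{V}_3=\frac{K(\kappa_2^2+\kappa_3^2)V_1+(\kappa_2N-\kappa_3L)\kappa_3V_2+(\kappa_2N-\kappa_3L)\kappa_2V_4}{W\sqrt{\kappa_2^2+\kappa_3^2}},$$ $$\overline{V}_4=\frac{(\kappa_2N-\kappa_3L)V_1+\kappa_3KV_2+\kappa_2KV_4}{W},$$ and $$\overline{\kappa}_1=\frac{\sqrt{\kappa_2^2+\kappa_3^2}}{|\phi|},\qquad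 \overline{\kappa}_2=\frac{W}{\phi^2(\kappa_2^2+\kappa_3^2)},$$ $$\overline{\kappa}_3=\frac{(\kappa_2N-\kappa_3L)(\kappa_1L+K')+(\kappa_2N'-\kappa_3L')K+\kappa_1\kappa_3K^2}{W\phi^4\,\overline{\kappa}_1\overline{\kappa}_2}.$$
   Context: Primes denote $d/ds$. For a curve $y$ in $\mathbb{E}^4$ with speed $v=\|y'\|$, the Frenet frame is an orthonormal frame $V_1=y'/\|y'\|,V_2,V_3,V_4$ along $y$, and the Frenet curvatures are functions $\kappa_1,\kappa_2,\kappa_3$, with $V_1'=v\kappa_1V_2$, $V_2'=v(-\kappa_1V_1+\kappa_2V_3)$, $V_3'=v(-\kappa_2V_2+\kappa_3V_4)$, $V_4'=-v\kappa_3V_3$. With $\wedge$ the ternary exterior (vector) product in $\mathbb{E}^4$, they are given by $V_4=\frac{y'\wedge y''\wedge y'''}{\|y'\wedge y''\wedge y'''\|}$, $V_3=\frac{V_4\wedge y'\wedge y''}{\|V_4\wedge y'\wedge y''\|}$, $V_2=\frac{V_3\wedge V_4\wedge y'}{\|V_3\wedge V_4\wedge y'\|}$, $\kappa_1=\frac{\langle V_2,y''\rangle}{\|y'\|^2}$, $\kappa_2=\frac{\langle V_3,y'''\rangle}{\|y'\|^3\kappa_1}$, $\kappa_3=\frac{\langle V_4,y''''\rangle}{\|y'\|^4\kappa_1\kappa_2}$. An involute of order $2$ of a unit speed curve $x$ is a curve $\overline{x}=x+\lambda_1V_1+\lambda_2V_2$ with differentiable $\lambda_1,\lambda_2$ such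 that $\langle\overline{x}',V_1\rangle=\langle\overline{x}',V_2\rangle=0$, i.e. $\lambda_1'=\kappa_1\lambda_2-1$, $\lambda_2'=-\kappa_1\lambda_1$.
   Formalization: Corrected: −(κ2N−κ3L) replaces κ2N−κ3L in the V1-term of V̄4 and in the first term of the numerator of κ̄3; V̄1 and V̄2 carry the factor sgn φ; the rule for V3 uses V4∧y''∧y' instead of V4∧y'∧y''; x is taken smooth and x̄ regular. *)

theory Defs
  imports "HOL-Analysis.Analysis"
begin

definition vderiv :: "nat \<Rightarrow> (real \<Rightarrow> 'a::real_normed_vector) \<Rightarrow> real \<Rightarrow> 'a" where
  "vderiv n f = ((\<lambda>g t. vector_derivative g (at t)) ^^ n) f"

definition times_differentiable_on :: "nat \<Rightarrow> real set \<Rightarrow> (real \<Rightarrow> 'a::real_normed_vector) \<Rightarrow> bool" where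
  "times_differentiable_on m I f \<longleftrightarrow> (\<forall>n<m. \<forall>s\<in>I. vderiv n f differentiable (at s))"

definition smooth_curve_on :: "real set \<Rightarrow> (real \<Rightarrow> 'a::real_normed_vector) \<Rightarrow> bool" where
  "smooth_curve_on I f \<longleftrightarrow> (\<forall>m. times_differentiable_on m I f)"

definition regular_on :: "real set \<Rightarrow> (real \<Rightarrow> 'a::real_normed_vector) \<Rightarrow> bool" where
  "regular_on I y \<longleftrightarrow> (\<forall>s\<in>I. vector_derivative y (at s) \<noteq> 0)"

definition unit_speed_on :: "real set \<Rightarrow> (real \<Rightarrow> 'a::real_normed_vector) \<Rightarrow> bool" where
  "unit_speed_on I y \<longleftrightarrow> (\<forall>s\<in>I. norm (vector_derivative y (at s)) = 1)"

text \<open>The ternary vector product of four-space: \<open>cross4 a b c \<bullet> d\<close> is the determinant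
  with rows \<open>a, b, c, d\<close>; in particular the product of the first three standard basis vectors
  is the fourth.\<close>

definition cross4 :: "real^4 \<Rightarrow> real^4 \<Rightarrow> real^4 \<Rightarrow> real^4" where
  "cross4 a b c = (\<chi> i. det (vector [a, b, c, axis i 1] :: real^4^4))"

definition orthonormal4 :: "real^4 \<Rightarrow> real^4 \<Rightarrow> real^4 \<Rightarrow> real^4 \<Rightarrow> bool" where
  "orthonormal4 a b c d \<longleftrightarrow>
     norm a = 1 \<and> norm b = 1 \<and> norm c = 1 \<and> norm d = 1 \<and>
     a \<bullet> b = 0 \<and> a \<bullet> c = 0 \<and> a \<bullet> d = 0 \<and> b \<bullet> c = 0 \<and> b \<bullet> d = 0 \<and> c \<bullet> d = 0"

text \<open>On vectors, \<^term>\<open>sgn\<close> is normalisation to length one. The order of the factors in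
  the formula for \<open>V3\<close> matters: a cyclic shift of four vectors is an odd permutation, so
  normalising \<open>cross4 (V4 s) (y' s) (y'' s)\<close> instead would reverse \<open>V3\<close> and then \<open>V2\<close>, and make
  the first curvature negative.\<close>

definition frenet_frame4 ::
  "real set \<Rightarrow> (real \<Rightarrow> real^4) \<Rightarrow> (real \<Rightarrow> real^4) \<Rightarrow> (real \<Rightarrow> real^4) \<Rightarrow> (real \<Rightarrow> real^4) \<Rightarrow> (real \<Rightarrow> real^4)
    \<Rightarrow> (real \<Rightarrow> real) \<Rightarrow> (real \<Rightarrow> real) \<Rightarrow> (real \<Rightarrow> real) \<Rightarrow> bool" where
  "frenet_frame4 I y V1 V2 V3 V4 k1 k2 k3 \<longleftrightarrow>
     times_differentiable_on 4 I y \<and> regular_on I y \<and>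
     (\<forall>s\<in>I.
        let y1 = vderiv 1 y s; y2 = vderiv 2 y s; y3 = vderiv 3 y s; y4 = vderiv 4 y s; v = norm y1
        in orthonormal4 (V1 s) (V2 s) (V3 s) (V4 s) \<and>
           V1 s = sgn y1 \<and>
           V4 s = sgn (cross4 y1 y2 y3) \<and>
           V3 s = sgn (cross4 (V4 s) y2 y1) \<and>
           V2 s = sgn (cross4 (V3 s) (V4 s) y1) \<and>
           k1 s = (V2 s \<bullet> y2) / v ^ 2 \<and>
           k2 s = (V3 s \<bullet> y3) / (v ^ 3 * k1 s) \<and>
           k3 s = (V4 s \<bullet> y4) / (v ^ 4 * k1 s * k2 s) \<and>
           (V1 has_vector_derivative (v * k1 s) *\<^sub>R V2 s) (at s) \<and>
           (V2 has_vector_derivative v *\<^sub>R (- k1 s *\<^sub>R V1 s + k2 s *\<^sub>R V3 s)) (at s) \<and>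
           (V3 has_vector_derivative v *\<^sub>R (- k2 s *\<^sub>R V2 s + k3 s *\<^sub>R V4 s)) (at s) \<and>
           (V4 has_vector_derivative - (v * k3 s) *\<^sub>R V3 s) (at s))"

definition involute2 ::
  "real set \<Rightarrow> (real \<Rightarrow> real^4) \<Rightarrow> (real \<Rightarrow> real^4) \<Rightarrow> (real \<Rightarrow> real^4)
    \<Rightarrow> (real \<Rightarrow> real) \<Rightarrow> (real \<Rightarrow> real) \<Rightarrow> (real \<Rightarrow> real^4) \<Rightarrow> bool" where
  "involute2 I x V1 V2 l1 l2 xb \<longleftrightarrow>
     xb = (\<lambda>s. x s + l1 s *\<^sub>R V1 s + l2 s *\<^sub>R V2 s) \<and>
     (\<forall>s\<in>I. l1 differentiable (at s) \<and> l2 differentiable (at s) \<and>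
        vector_derivative xb (at s) \<bullet> V1 s = 0 \<and> vector_derivative xb (at s) \<bullet> V2 s = 0)"

end

theory Submission
  imports Defs
begin

text \<open>The involute satisfies \<open>xb' = \<phi> V3\<close>, so its higher derivatives are found in the frame
  \<open>V1, V2, V3, V4\<close> by repeated use of the Frenet equations of \<open>x\<close>, and they are triangular in the
  claimed frame. A positively oriented orthonormal frame in which the first three derivatives of \<open>y\<close>
  are triangular with positive diagonal is the Frenet frame of \<open>y\<close>, and the diagonal gives the
  first two curvatures.\<close>

text \<open>Regularity of \<open>xb\<close> gives \<phi> \<noteq> 0 but no sign, so the speed is
  \<bar>\<phi>\<bar> and \<open>sgn\<close> of \<phi> enters both \<open>V1b\<close> and
  \<open>V2b\<close>. In their product with \<open>V3b\<close> it squares to 1, so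
  \<open>V3b\<close> and \<open>V4b\<close> are free of it. Positive orientation then forces the
  minus sign before \<kappa>2 N - \<kappa>3 L in \<open>V4b\<close>, and with it the one in
  \<open>\<kappa>3b\<close>. The obstacle is regularity. The hypotheses state one derivative of the
  frame, of \<open>l1\<close> and of \<open>l2\<close>, while the fourth derivative of
  \<open>xb\<close> contains three derivatives of \<phi>. The missing orders are recovered from
  first-order equations whose right-hand sides are as regular as the unknowns themselves.\<close>

subsection \<open>The ternary vector product\<close>

lemma vector_4:
  "(vector [a, b, c, d] :: ('a::zero)^4) $ 1 = a"
  "(vector [a, b, c, d] :: ('a::zero)^4) $ 2 = b"
  "(vector [a, b, c, d] :: ('a::zero)^4) $ 3 = c"
  "(vector [a, b, c, d] :: ('a::zero)^4) $ 4 = d"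
  by (simp_all add: vector_def)

text \<open>Every permutation of \<open>insert a S\<close> is uniquely a transposition moving
  \<open>a\<close>, possibly trivial, composed with a permutation of \<open>S\<close>. Three such
  splittings leave 24 explicit terms.\<close>

lemma det_4:
  fixes A :: "'a::comm_ring_1^4^4"
  shows "det A =
    A$1$1 * (A$2$2 * (A$3$3 * A$4$4 - A$3$4 * A$4$3) - A$2$3 * (A$3$2 * A$4$4 - A$3$4 * A$4$2)
      + A$2$4 * (A$3$2 * A$4$3 - A$3$3 * A$4$2))
  - A$1$2 * (A$2$1 * (A$3$3 * A$4$4 - A$3$4 * A$4$3) - A$2$3 * (A$3$1 * A$4$4 - A$3$4 * A$4$1)
      + A$2$4 * (A$3$1 * A$4$3 - A$3$3 * A$4$1))
  + A$1$3 * (A$2$1 * (A$3$2 * A$4$4 - A$3$4 * A$4$2) - A$2$2 * (A$3$1 * A$4$4 - A$3$4 * A$4$1)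
      + A$2$4 * (A$3$1 * A$4$2 - A$3$2 * A$4$1))
  - A$1$4 * (A$2$1 * (A$3$2 * A$4$3 - A$3$3 * A$4$2) - A$2$2 * (A$3$1 * A$4$3 - A$3$3 * A$4$1)
      + A$2$3 * (A$3$1 * A$4$2 - A$3$2 * A$4$1))"
proof -
  have f: "finite {2::4, 3, 4}" "1 \<notin> {2::4, 3, 4}"
    "finite {3::4, 4}" "2 \<notin> {3::4, 4}" "finite {4::4}" "3 \<notin> {4::4}"
    by auto
  show ?thesis
    unfolding det_def UNIV_4
    unfolding sum_over_permutations_insert[OF f(1,2)]
    unfolding sum_over_permutations_insert[OF f(3,4)]
    unfolding sum_over_permutations_insert[OF f(5,6)]
    unfolding permutes_sing
    by (simp add: sign_swap_id permutation_swap_id permutation_compose sign_compose sign_id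
        transpose_eq_iff transpose_def algebra_simps)
qed

text \<open>These are the cofactors of the last row, whence the alternating signs. They turn the
  algebraic laws of \<open>cross4\<close> into polynomial identities in coordinates.\<close>

lemma cross4_component:
  "cross4 a b c $ 1 = - (a$2 * (b$3 * c$4 - b$4 * c$3) - a$3 * (b$2 * c$4 - b$4 * c$2) + a$4 * (b$2 * c$3 - b$3 * c$2))"
  "cross4 a b c $ 2 = a$1 * (b$3 * c$4 - b$4 * c$3) - a$3 * (b$1 * c$4 - b$4 * c$1) + a$4 * (b$1 * c$3 - b$3 * c$1)"
  "cross4 a b c $ 3 = - (a$1 * (b$2 * c$4 - b$4 * c$2) - a$2 * (b$1 * c$4 - b$4 * c$1) + a$4 * (b$1 * c$2 - b$2 * c$1))"
  "cross4 a b c $ 4 = a$1 * (b$2 * c$3 - b$3 * c$2) - a$2 * (b$1 * c$3 - b$3 * c$1) + a$3 * (b$1 * c$2 - b$2 * c$1)"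
  by (simp_all add: cross4_def det_4 vector_4 axis_def algebra_simps)

lemma cross4_inner: "cross4 a b c \<bullet> d = det (vector [a, b, c, d] :: real^4^4)"
  by (simp add: det_4 vector_4 inner_vec_def sum_4 cross4_component algebra_simps)

lemma cross4_add:
  "cross4 (a + a') b c = cross4 a b c + cross4 a' b c"
  "cross4 a (b + b') c = cross4 a b c + cross4 a b' c"
  "cross4 a b (c + c') = cross4 a b c + cross4 a b c'"
  by (simp_all add: vec_eq_iff forall_4 cross4_component algebra_simps)

lemma cross4_scaleR:
  "cross4 (r *\<^sub>R a) b c = r *\<^sub>R cross4 a b c"
  "cross4 a (r *\<^sub>R b) c = r *\<^sub>R cross4 a b c"
  "cross4 a b (r *\<^sub>R c) = r *\<^sub>R cross4 a b c"
  by (simp_all add: vec_eq_iff forall_4 cross4_component algebra_simps)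

lemma cross4_swap12: "cross4 b a c = - cross4 a b c"
  and cross4_swap23: "cross4 a c b = - cross4 a b c"
  by (simp_all add: vec_eq_iff forall_4 cross4_component algebra_simps)

lemma cross4_repeat: "cross4 a a c = 0" "cross4 a b a = 0" "cross4 a b b = 0"
  by (simp_all add: vec_eq_iff forall_4 cross4_component algebra_simps)

lemma cross4_inner_self: "cross4 a b c \<bullet> a = 0" "cross4 a b c \<bullet> b = 0" "cross4 a b c \<bullet> c = 0"
  by (simp_all add: inner_vec_def sum_4 cross4_component algebra_simps)

section \<open>Orthonormal frames of four-space\<close>

lemma orthonormal4_inner:
  assumes "orthonormal4 a b c d"
  shows "a \<bullet> a = 1" "b \<bullet> b = 1" "c \<bullet> c = 1" "d \<bullet> d = 1"
    "a \<bullet> b = 0" "a \<bullet> c = 0" "a \<bullet> d = 0" "b \<bullet> c = 0" "b \<bullet> d = 0" "c \<bullet> d = 0"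
    "b \<bullet> a = 0" "c \<bullet> a = 0" "d \<bullet> a = 0" "c \<bullet> b = 0" "d \<bullet> b = 0" "d \<bullet> c = 0"
  using assms by (auto simp: orthonormal4_def norm_eq_1 inner_commute)

lemma orthonormal4I:
  assumes "a \<bullet> a = 1" "b \<bullet> b = 1" "c \<bullet> c = 1" "d \<bullet> d = 1"
    "a \<bullet> b = 0" "a \<bullet> c = 0" "a \<bullet> d = 0" "b \<bullet> c = 0" "b \<bullet> d = 0" "c \<bullet> d = 0"
  shows "orthonormal4 a b c d"
  using assms by (simp add: orthonormal4_def norm_eq_1)

text \<open>The rows form an orthogonal matrix. Only the sign stays open; for a Frenet frame the
  formula for \<open>V2\<close> will decide it.\<close>

lemma orthonormal4_det:
  assumes "orthonormal4 a b c d"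
  shows "cross4 a b c \<bullet> d = 1 \<or> cross4 a b c \<bullet> d = - 1"
proof -
  have "orthogonal_matrix (vector [a, b, c, d] :: real^4^4)"
    unfolding orthogonal_matrix_orthonormal_rows
    using assms by (simp add: forall_4 row_def vector_4 orthonormal4_def orthogonal_def inner_commute)
  then show ?thesis
    unfolding cross4_inner by (rule det_orthogonal_matrix)
qed

text \<open>For a square matrix, orthonormal rows also give \<open>transpose Q ** Q = mat 1\<close>,
  and this identity applied to \<open>u\<close> is the expansion.\<close>

lemma orthonormal4_expand:
  assumes "orthonormal4 a b c d"
  shows "u = (u \<bullet> a) *\<^sub>R a + (u \<bullet> b) *\<^sub>R b + (u \<bullet> c) *\<^sub>R c + (u \<bullet> d) *\<^sub>R d"
proof -
  define Q where "Q = (vector [a, b, c, d] :: real^4^4)"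
  have "orthogonal_matrix Q"
    unfolding orthogonal_matrix_orthonormal_rows
    using assms by (simp add: Q_def forall_4 row_def vector_4 orthonormal4_def orthogonal_def inner_commute)
  then have "u = transpose Q *v (Q *v u)"
    by (simp add: orthogonal_matrix matrix_vector_mul_assoc)
  then show ?thesis
    unfolding vec_eq_iff matrix_vector_mult_def
    by (simp add: forall_4 sum_4 Q_def vector_4 transpose_def inner_vec_def algebra_simps)
qed

lemma orthonormal4_eqI:
  assumes "orthonormal4 a b c d" "u \<bullet> a = w \<bullet> a" "u \<bullet> b = w \<bullet> b" "u \<bullet> c = w \<bullet> c" "u \<bullet> d = w \<bullet> d"
  shows "u = w"
  using orthonormal4_expand[OF assms(1)] assms(2-) by metis

text \<open>Each product is orthogonal to its three factors, hence a multiple of the missing frame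
  vector. The coefficient is the determinant with permuted rows, so the sign of the
  permutation.\<close>

lemma cross4_frame:
  assumes "orthonormal4 a b c d" and "cross4 a b c \<bullet> d = 1"
  shows "cross4 a b c = d" "cross4 a b d = - c" "cross4 a c d = b" "cross4 b c d = - a"
proof -
  have 1: "cross4 a b d \<bullet> c = - 1" "cross4 a c d \<bullet> b = 1" "cross4 b c d \<bullet> a = - 1"
    using assms(2) by (simp_all add: inner_vec_def sum_4 cross4_component algebra_simps)
  note s = orthonormal4_inner[OF assms(1)] cross4_inner_self assms(2) 1
  show "cross4 a b c = d" "cross4 a b d = - c" "cross4 a c d = b" "cross4 b c d = - a"
    by (rule orthonormal4_eqI[OF assms(1)]; simp add: s)+
qed

subsection \<open>Iterated differentiability\<close>

lemma vderiv_0: "vderiv 0 f = f"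
  and vderiv_Suc: "vderiv (Suc n) f s = vector_derivative (vderiv n f) (at s)"
  by (simp_all add: vderiv_def)

lemma vderiv_Suc_shift: "vderiv (Suc n) f = vderiv n (vderiv 1 f)"
  by (simp add: vderiv_def funpow_Suc_right del: funpow.simps(2))

lemma vderiv_cong:
  assumes "open I" "\<And>s. s \<in> I \<Longrightarrow> f s = g s" "s \<in> I"
  shows "vderiv n f s = vderiv n g s"
  using assms(3)
proof (induction n arbitrary: s)
  case 0
  then show ?case using assms(2) by (simp add: vderiv_0)
next
  case (Suc n)
  have "eventually (\<lambda>t. t \<in> I) (nhds s)"
    using assms(1) Suc.prems by (rule eventually_nhds_in_open)
  then have "eventually (\<lambda>t. t \<in> UNIV \<longrightarrow> vderiv n f t = vderiv n g t) (nhds s)"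
    by eventually_elim (simp add: Suc.IH)
  then show ?case
    unfolding vderiv_Suc by (rule vector_derivative_cong_eq) auto
qed

text \<open>Because \<open>I\<close> is open, a formula for a derivative that is known only on
  \<open>I\<close> may be differentiated there. The higher derivatives of the involute are computed
  one from another in this way.\<close>

lemma vderiv_SucI:
  assumes "open I" "\<And>s. s \<in> I \<Longrightarrow> vderiv n f s = g s" "s \<in> I"
    and "(g has_vector_derivative g') (at s)"
  shows "vderiv (Suc n) f s = g'"
proof -
  have "(vderiv n f has_vector_derivative g') (at s)"
    by (rule has_vector_derivative_transform_within_open[OF assms(4,1,3)]) (simp add: assms(2))
  then show ?thesis
    unfolding vderiv_Suc by (rule vector_derivative_at)
qed

lemma times_differentiable_on_0 [simp]: "times_differentiable_on 0 I f"
  by (simp add: times_differentiable_on_def)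

text \<open>Peeling off the first derivative, not the last, lowers the order for a new function.
  Closure under sums and products is therefore proved by induction with the functions
  arbitrary.\<close>

lemma times_differentiable_on_Suc:
  "times_differentiable_on (Suc m) I f \<longleftrightarrow>
    (\<forall>s\<in>I. f differentiable (at s)) \<and> times_differentiable_on m I (vderiv 1 f)"
  unfolding times_differentiable_on_def All_less_Suc2 vderiv_Suc_shift vderiv_0 by blast

lemma times_differentiable_on_mono:
  "times_differentiable_on m I f \<Longrightarrow> n \<le> m \<Longrightarrow> times_differentiable_on n I f"
  by (auto simp: times_differentiable_on_def)

lemma times_differentiable_on_cong:
  assumes "open I" "\<And>s. s \<in> I \<Longrightarrow> f s = g s" "times_differentiable_on m I g"
  shows "times_differentiable_on m I f"
  unfolding times_differentiable_on_def
proof (intro allI impI ballI)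
  fix n s assume n: "n < m" and s: "s \<in> I"
  then have "vderiv n g differentiable (at s)"
    using assms(3) by (simp add: times_differentiable_on_def)
  then obtain g' where "(vderiv n g has_vector_derivative g') (at s)"
    by (auto simp: vector_derivative_works)
  then have "(vderiv n f has_vector_derivative g') (at s)"
    by (rule has_vector_derivative_transform_within_open[OF _ assms(1) s])
       (rule vderiv_cong[OF assms(1) assms(2), symmetric])
  then show "vderiv n f differentiable (at s)"
    by (rule differentiableI_vector)
qed

lemma times_differentiable_on_SucI:
  assumes "open I" "\<And>s. s \<in> I \<Longrightarrow> (f has_vector_derivative f' s) (at s)"
    and "times_differentiable_on m I f'"
  shows "times_differentiable_on (Suc m) I f"
  unfolding times_differentiable_on_Suc
proof
  show "\<forall>s\<in>I. f differentiable (at s)"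
    using assms(2) by (blast intro: differentiableI_vector)
  show "times_differentiable_on m I (vderiv 1 f)"
    by (rule times_differentiable_on_cong[OF assms(1) _ assms(3)])
       (use assms(2) in \<open>simp add: vderiv_def vector_derivative_at\<close>)
qed

lemma times_differentiable_on_has_vderiv:
  assumes "times_differentiable_on (Suc m) I f" "s \<in> I"
  shows "(f has_vector_derivative vderiv 1 f s) (at s)"
  using assms unfolding times_differentiable_on_Suc
  by (simp add: vderiv_def vector_derivative_works)

lemma times_differentiable_on_const: "open I \<Longrightarrow> times_differentiable_on m I (\<lambda>s. c)"
proof (induction m arbitrary: c)
  case (Suc m)
  show ?case
    by (rule times_differentiable_on_SucI[OF Suc.prems _ Suc.IH[OF Suc.prems, of 0]]) simp
qed simp

lemma times_differentiable_on_add: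
  "open I \<Longrightarrow> times_differentiable_on m I f \<Longrightarrow> times_differentiable_on m I g \<Longrightarrow>
    times_differentiable_on m I (\<lambda>s. f s + g s)"
proof (induction m arbitrary: f g)
  case (Suc m)
  show ?case
  proof (rule times_differentiable_on_SucI[OF Suc.prems(1)])
    show "((\<lambda>s. f s + g s) has_vector_derivative vderiv 1 f s + vderiv 1 g s) (at s)" if "s \<in> I" for s
      using that Suc.prems by (intro has_vector_derivative_add times_differentiable_on_has_vderiv)
    show "times_differentiable_on m I (\<lambda>s. vderiv 1 f s + vderiv 1 g s)"
      using Suc.prems by (intro Suc.IH) (simp_all add: times_differentiable_on_Suc)
  qed
qed simp

text \<open>By the Leibniz rule the derivative is again a sum of values of \<open>h\<close>, in
  which one argument is differentiated and the other is used at the lower order. Products, scalings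
  and inner products are instances.\<close>

lemma times_differentiable_on_bilinear:
  assumes "bounded_bilinear h"
  shows "open I \<Longrightarrow> times_differentiable_on m I f \<Longrightarrow> times_differentiable_on m I g \<Longrightarrow>
    times_differentiable_on m I (\<lambda>s. h (f s) (g s))"
proof (induction m arbitrary: f g)
  case (Suc m)
  note less = times_differentiable_on_mono[of "Suc m" _ _ m, simplified]
  show ?case
  proof (rule times_differentiable_on_SucI[OF Suc.prems(1)])
    show "((\<lambda>s. h (f s) (g s)) has_vector_derivative h (f s) (vderiv 1 g s) + h (vderiv 1 f s) (g s)) (at s)"
      if "s \<in> I" for s
      using that Suc.prems
      by (intro bounded_bilinear.has_vector_derivative[OF assms] times_differentiable_on_has_vderiv)
    show "times_differentiable_on m I (\<lambda>s. h (f s) (vderiv 1 g s) + h (vderiv 1 f s) (g s))"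
      using Suc.prems less[OF Suc.prems(2)] less[OF Suc.prems(3)]
      by (intro times_differentiable_on_add Suc.IH) (simp_all add: times_differentiable_on_Suc)
  qed
qed simp

lemmas times_differentiable_on_mult =
  times_differentiable_on_bilinear[OF bounded_bilinear_mult]
lemmas times_differentiable_on_scaleR =
  times_differentiable_on_bilinear[OF bounded_bilinear_scaleR]
lemmas times_differentiable_on_inner =
  times_differentiable_on_bilinear[OF bounded_bilinear_inner]

lemma times_differentiable_on_minus:
  assumes "open I" "times_differentiable_on m I f"
  shows "times_differentiable_on m I (\<lambda>s. - f s)"
  using times_differentiable_on_scaleR[OF assms(1) times_differentiable_on_const[OF assms(1), where c = "-1"] assms(2)]
  by simp

lemma times_differentiable_on_diff:
  assumes "open I" "times_differentiable_on m I f" "times_differentiable_on m I g"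
  shows "times_differentiable_on m I (\<lambda>s. f s - g s)"
  using times_differentiable_on_add[OF assms(1,2) times_differentiable_on_minus[OF assms(1,3)]] by simp

text \<open>The derivative is written with \<open>inverse (f s)\<close> as a repeated factor, so
  that the induction hypothesis and the product rule apply to it directly.\<close>

lemma times_differentiable_on_inverse:
  fixes f :: "real \<Rightarrow> real"
  assumes "open I" "\<And>s. s \<in> I \<Longrightarrow> f s \<noteq> 0"
  shows "times_differentiable_on m I f \<Longrightarrow> times_differentiable_on m I (\<lambda>s. inverse (f s))"
proof (induction m)
  case (Suc m)
  note less = times_differentiable_on_mono[of "Suc m" _ _ m, simplified]
  show ?case
  proof (rule times_differentiable_on_SucI[OF assms(1)])
    show "((\<lambda>s. inverse (f s)) has_vector_derivative - (inverse (f s) * vderiv 1 f s * inverse (f s))) (at s)"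
      if "s \<in> I" for s
      using times_differentiable_on_has_vderiv[OF Suc.prems that] assms(2)[OF that]
      unfolding has_real_derivative_iff_has_vector_derivative[symmetric] by (rule DERIV_inverse')
    show "times_differentiable_on m I (\<lambda>s. - (inverse (f s) * vderiv 1 f s * inverse (f s)))"
      using Suc.prems less[OF Suc.prems] assms(1)
      by (intro times_differentiable_on_minus times_differentiable_on_mult Suc.IH)
        (simp_all add: times_differentiable_on_Suc)
  qed
qed simp

lemma times_differentiable_on_divide:
  fixes f g :: "real \<Rightarrow> real"
  assumes "open I" "times_differentiable_on m I f" "times_differentiable_on m I g"
    and "\<And>s. s \<in> I \<Longrightarrow> g s \<noteq> 0"
  shows "times_differentiable_on m I (\<lambda>s. f s / g s)"
  using times_differentiable_on_mult[OF assms(1,2) times_differentiable_on_inverse[OF assms(1,4,3)]]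
  by (simp add: divide_inverse)

section \<open>Smooth functions, square roots and signs\<close>

lemma smooth_curve_on_vderiv: "smooth_curve_on I f \<Longrightarrow> smooth_curve_on I (vderiv n f)"
proof (induction n)
  case (Suc n)
  have "vderiv (Suc n) f = vderiv 1 (vderiv n f)"
    by (simp add: vderiv_def fun_eq_iff)
  then show ?case
    using Suc unfolding smooth_curve_on_def by (metis times_differentiable_on_Suc)
qed (simp add: vderiv_0)

lemma smooth_curve_on_DERIV:
  fixes f :: "real \<Rightarrow> real"
  assumes "smooth_curve_on I f" "s \<in> I"
  shows "(f has_real_derivative deriv f s) (at s)"
proof -
  have "(f has_vector_derivative vderiv 1 f s) (at s)"
    using assms unfolding smooth_curve_on_def by (blast intro: times_differentiable_on_has_vderiv)
  then show ?thesis
    unfolding has_real_derivative_iff_has_vector_derivative[symmetric]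
    by (metis DERIV_imp_deriv)
qed

lemma smooth_curve_on_deriv:
  fixes f :: "real \<Rightarrow> real"
  assumes "open I" "smooth_curve_on I f"
  shows "smooth_curve_on I (deriv f)"
  unfolding smooth_curve_on_def
proof
  fix m
  show "times_differentiable_on m I (deriv f)"
  proof (rule times_differentiable_on_cong[OF assms(1)])
    show "deriv f s = vderiv 1 f s" if "s \<in> I" for s
      using smooth_curve_on_DERIV[OF assms(2) that]
      unfolding has_real_derivative_iff_has_vector_derivative
      by (simp add: vderiv_def vector_derivative_at)
    show "times_differentiable_on m I (vderiv 1 f)"
      using smooth_curve_on_vderiv[OF assms(2)] by (simp add: smooth_curve_on_def)
  qed
qed

lemma smooth_curve_on_differentiable: "smooth_curve_on I f \<Longrightarrow> s \<in> I \<Longrightarrow> f differentiable (at s)"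
  unfolding smooth_curve_on_def using times_differentiable_on_Suc by blast

lemma smooth_curve_on_const: "open I \<Longrightarrow> smooth_curve_on I (\<lambda>s. c)"
  by (simp add: smooth_curve_on_def times_differentiable_on_const)

lemma smooth_curve_on_add:
  "open I \<Longrightarrow> smooth_curve_on I f \<Longrightarrow> smooth_curve_on I g \<Longrightarrow> smooth_curve_on I (\<lambda>s. f s + g s)"
  by (simp add: smooth_curve_on_def times_differentiable_on_add)

lemma smooth_curve_on_diff:
  "open I \<Longrightarrow> smooth_curve_on I f \<Longrightarrow> smooth_curve_on I g \<Longrightarrow> smooth_curve_on I (\<lambda>s. f s - g s)"
  by (simp add: smooth_curve_on_def times_differentiable_on_diff)

lemma smooth_curve_on_mult:
  fixes f g :: "real \<Rightarrow> real"
  shows "open I \<Longrightarrow> smooth_curve_on I f \<Longrightarrow> smooth_curve_on I g \<Longrightarrow> smooth_curve_on I (\<lambda>s. f s * g s)"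
  by (simp add: smooth_curve_on_def times_differentiable_on_mult)

lemma smooth_curve_on_scaleR:
  "open I \<Longrightarrow> smooth_curve_on I f \<Longrightarrow> smooth_curve_on I g \<Longrightarrow> smooth_curve_on I (\<lambda>s. f s *\<^sub>R g s)"
  by (simp add: smooth_curve_on_def times_differentiable_on_scaleR)

lemma differentiable_real_sqrt:
  fixes f :: "real \<Rightarrow> real"
  assumes "f differentiable (at s)" "0 < f s"
  shows "(\<lambda>t. sqrt (f t)) differentiable (at s)"
  using assms unfolding differentiable_def by (blast intro: has_derivative_real_sqrt)

lemma sgn_differentiable:
  fixes f :: "real \<Rightarrow> real"
  assumes "f differentiable (at s)" "f s \<noteq> 0"
  shows "(\<lambda>t. sgn (f t)) differentiable (at s)"
proof -
  have "(\<lambda>t. f t / sqrt ((f t)\<^sup>2)) differentiable (at s)"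
    using assms by (intro differentiable_divide differentiable_real_sqrt differentiable_power) auto
  \<comment> \<open>The two functions agree everywhere, also at zeros of \<open>f\<close>, because
    division by zero yields 0. The usual rules then replace an argument by local constancy of the
    sign.\<close>
  moreover have "(\<lambda>t. f t / sqrt ((f t)\<^sup>2)) = (\<lambda>t. sgn (f t))"
    by (auto simp: sgn_real_def fun_eq_iff)
  ultimately show ?thesis by simp
qed

subsection \<open>Frenet frames\<close>

text \<open>For pairs of frame vectors this is the skew symmetry of the Frenet matrix, and for
  \<open>f = g\<close> the vanishing of its diagonal. It also serves for frame vectors orthogonal to
  derivatives of the curve.\<close>

lemma inner_const_derivative:
  fixes f g :: "real \<Rightarrow> 'a::real_inner"
  assumes "open I" "s \<in> I" "\<And>t. t \<in> I \<Longrightarrow> f t \<bullet> g t = c"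
    and "(f has_vector_derivative f') (at s)" "(g has_vector_derivative g') (at s)"
  shows "f' \<bullet> g s = - (f s \<bullet> g')"
proof -
  have "((\<lambda>t. f t \<bullet> g t) has_vector_derivative f s \<bullet> g' + f' \<bullet> g s) (at s)"
    by (rule bounded_bilinear.has_vector_derivative[OF bounded_bilinear_inner assms(4,5)])
  moreover have "((\<lambda>t. f t \<bullet> g t) has_vector_derivative 0) (at s)"
    by (rule has_vector_derivative_transform_within_open[OF has_vector_derivative_const assms(1,2)])
       (simp add: assms(3))
  ultimately show ?thesis
    using vector_derivative_unique_at by fastforce
qed

text \<open>The coordinates of the derivatives of \<open>E1, \<dots>, E4\<close> are read off from the constancy of the
  inner products of the frame and from the triangular expansion of the derivatives of \<open>y\<close>.\<close>

lemma frenet_frame4I: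
  fixes y E1 E2 E3 E4 :: "real \<Rightarrow> real^4" and v a b c1 c2 d k1 k2 k3 :: "real \<Rightarrow> real"
  assumes I: "open I" and td: "times_differentiable_on 4 I y"
    and diff: "\<And>s. s \<in> I \<Longrightarrow> E1 differentiable (at s) \<and> E2 differentiable (at s) \<and>
      E3 differentiable (at s) \<and> E4 differentiable (at s)"
    and on: "\<And>s. s \<in> I \<Longrightarrow> orthonormal4 (E1 s) (E2 s) (E3 s) (E4 s)"
    and pos: "\<And>s. s \<in> I \<Longrightarrow> cross4 (E1 s) (E2 s) (E3 s) \<bullet> E4 s = 1"
    and y1: "\<And>s. s \<in> I \<Longrightarrow> vderiv 1 y s = v s *\<^sub>R E1 s"
    and y2: "\<And>s. s \<in> I \<Longrightarrow> vderiv 2 y s = a s *\<^sub>R E1 s + b s *\<^sub>R E2 s"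
    and y3: "\<And>s. s \<in> I \<Longrightarrow> vderiv 3 y s = c1 s *\<^sub>R E1 s + c2 s *\<^sub>R E2 s + d s *\<^sub>R E3 s"
    and vbd: "\<And>s. s \<in> I \<Longrightarrow> 0 < v s \<and> 0 < b s \<and> 0 < d s"
    and k1: "\<And>s. s \<in> I \<Longrightarrow> k1 s = b s / v s ^ 2"
    and k2: "\<And>s. s \<in> I \<Longrightarrow> k2 s = d s / (v s ^ 3 * k1 s)"
    and k3: "\<And>s. s \<in> I \<Longrightarrow> k3 s = (E4 s \<bullet> vderiv 4 y s) / (v s ^ 4 * k1 s * k2 s)"
  shows "frenet_frame4 I y E1 E2 E3 E4 k1 k2 k3"
proof -
  have dy: "(vderiv n y has_vector_derivative vderiv (Suc n) y s) (at s)" if "n < 4" "s \<in> I" for n s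
    using td that unfolding times_differentiable_on_def vderiv_Suc vector_derivative_works by blast
  have reg: "regular_on I y"
    unfolding regular_on_def
  proof
    fix s assume s: "s \<in> I"
    have "norm (E1 s) = 1" using on[OF s] by (simp add: orthonormal4_def)
    then have "vderiv 1 y s \<noteq> 0"
      using y1[OF s] vbd[OF s] by auto
    then show "vector_derivative y (at s) \<noteq> 0" by (simp add: vderiv_def)
  qed
  show ?thesis
    unfolding frenet_frame4_def Let_def
  proof (intro conjI ballI)
    fix s assume s: "s \<in> I"
    have v: "0 < v s" and b: "0 < b s" and d: "0 < d s" using vbd[OF s] by auto
    have k1p: "0 < k1 s" using v b by (simp add: k1[OF s])
    have k2p: "0 < k2 s" using v d k1p by (simp add: k2[OF s])
    note o = orthonormal4_inner[OF on[OF s]]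
    have n1: "norm (E1 s) = 1" "norm (E2 s) = 1" "norm (E3 s) = 1" "norm (E4 s) = 1"
      using on[OF s] by (auto simp: orthonormal4_def)
    have nv: "norm (vderiv 1 y s) = v s" using v n1 by (simp add: y1[OF s] del: One_nat_def)
    note Y = y1[OF s] y2[OF s] y3[OF s]
    \<comment> \<open>Repeated factors kill everything above the diagonal of the triangular
      expansion, so each product below is a positive multiple of a single frame vector.\<close>
    note cr = cross4_add cross4_scaleR cross4_repeat cross4_frame[OF on[OF s] pos[OF s]]
    have sgnE: "sgn (r *\<^sub>R e) = e" if "0 < r" "norm e = 1" for r and e :: "real^4"
      using that by (simp add: sgn_div_norm)
    show "orthonormal4 (E1 s) (E2 s) (E3 s) (E4 s)" by (rule on[OF s])
    show "E1 s = sgn (vderiv 1 y s)"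
      using v n1 by (simp del: One_nat_def add: Y sgnE)
    have "cross4 (vderiv 1 y s) (vderiv 2 y s) (vderiv 3 y s) = (v s * b s * d s) *\<^sub>R E4 s"
      by (simp del: One_nat_def add: Y cr)
    then show "E4 s = sgn (cross4 (vderiv 1 y s) (vderiv 2 y s) (vderiv 3 y s))"
      using v b d n1 by (simp add: sgnE)
    \<comment> \<open>Exchanging the outer factors costs a sign, which cancels the one in
      \<open>cross4 E1 E2 E4 = - E3\<close>.\<close>
    have "cross4 (E4 s) (E2 s) (E1 s) = - cross4 (E1 s) (E2 s) (E4 s)"
      by (metis cross4_swap12 cross4_swap23)
    then have "cross4 (E4 s) (vderiv 2 y s) (vderiv 1 y s) = (b s * v s) *\<^sub>R E3 s"
      by (simp del: One_nat_def add: Y cr)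
    then show "E3 s = sgn (cross4 (E4 s) (vderiv 2 y s) (vderiv 1 y s))"
      using v b n1 by (simp add: sgnE)
    have "cross4 (E3 s) (E4 s) (E1 s) = cross4 (E1 s) (E3 s) (E4 s)"
      by (metis cross4_swap12 cross4_swap23 add.inverse_inverse)
    then have "cross4 (E3 s) (E4 s) (vderiv 1 y s) = v s *\<^sub>R E2 s"
      by (simp del: One_nat_def add: Y cr)
    then show "E2 s = sgn (cross4 (E3 s) (E4 s) (vderiv 1 y s))"
      using v n1 by (simp add: sgnE)
    show "k1 s = (E2 s \<bullet> vderiv 2 y s) / norm (vderiv 1 y s) ^ 2"
      by (simp del: One_nat_def add: nv k1[OF s]) (simp del: One_nat_def add: Y inner_simps o)
    show "k2 s = (E3 s \<bullet> vderiv 3 y s) / (norm (vderiv 1 y s) ^ 3 * k1 s)"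
      by (simp del: One_nat_def add: nv k2[OF s]) (simp del: One_nat_def add: Y inner_simps o)
    show "k3 s = (E4 s \<bullet> vderiv 4 y s) / (norm (vderiv 1 y s) ^ 4 * k1 s * k2 s)"
      by (simp del: One_nat_def add: nv k3[OF s])
    obtain D1 D2 D3 D4 where D: "(E1 has_vector_derivative D1) (at s)" "(E2 has_vector_derivative D2) (at s)"
      "(E3 has_vector_derivative D3) (at s)" "(E4 has_vector_derivative D4) (at s)"
      using diff[OF s] by (auto simp: vector_derivative_works)
    note fc = inner_const_derivative[OF I s]
    note O = orthonormal4_inner[OF on]
    have diag: "D1 \<bullet> E1 s = 0" "D2 \<bullet> E2 s = 0" "D3 \<bullet> E3 s = 0" "D4 \<bullet> E4 s = 0"
      using fc[OF O(1) D(1) D(1)] fc[OF O(2) D(2) D(2)] fc[OF O(3) D(3) D(3)] fc[OF O(4) D(4) D(4)]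
      by (simp_all add: inner_commute)
    have anti: "D1 \<bullet> E2 s = - (D2 \<bullet> E1 s)" "D1 \<bullet> E3 s = - (D3 \<bullet> E1 s)" "D1 \<bullet> E4 s = - (D4 \<bullet> E1 s)"
      "D2 \<bullet> E3 s = - (D3 \<bullet> E2 s)" "D2 \<bullet> E4 s = - (D4 \<bullet> E2 s)" "D3 \<bullet> E4 s = - (D4 \<bullet> E3 s)"
      using fc[OF O(5) D(1) D(2)] fc[OF O(6) D(1) D(3)] fc[OF O(7) D(1) D(4)]
        fc[OF O(8) D(2) D(3)] fc[OF O(9) D(2) D(4)] fc[OF O(10) D(3) D(4)]
      by (simp_all add: inner_commute)
    have dy1: "(vderiv 1 y has_vector_derivative vderiv 2 y s) (at s)"
      and dy2: "(vderiv 2 y has_vector_derivative vderiv 3 y s) (at s)"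
      and dy3: "(vderiv 3 y has_vector_derivative vderiv 4 y s) (at s)"
      using dy[of 1 s] dy[of 2 s] dy[of 3 s] s by (simp_all add: numeral_eq_Suc)
    \<comment> \<open>Each frame vector is orthogonal to the derivatives of lower order on all of
      \<open>I\<close>, so these relations can be differentiated. They give the six entries of the
      Frenet matrix below the diagonal, and skew symmetry gives those above.\<close>
    have z: "E2 t \<bullet> vderiv 1 y t = 0" "E3 t \<bullet> vderiv 1 y t = 0" "E4 t \<bullet> vderiv 1 y t = 0"
      "E3 t \<bullet> vderiv 2 y t = 0" "E4 t \<bullet> vderiv 2 y t = 0" "E4 t \<bullet> vderiv 3 y t = 0"
      if "t \<in> I" for t
      by (simp_all del: One_nat_def add: y1 y2 y3 that inner_simps O[OF that])
    have w1: "D2 \<bullet> E1 s = - (b s / v s)" "D3 \<bullet> E1 s = 0" "D4 \<bullet> E1 s = 0"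
      using fc[OF z(1) D(2) dy1] fc[OF z(2) D(3) dy1] fc[OF z(3) D(4) dy1] v
      by (simp_all del: One_nat_def add: Y inner_simps o field_simps)
    \<comment> \<open>The inner product with \<open>vderiv 2 y\<close> also involves the
      \<open>E1\<close> coordinate, which vanishes by \<open>w1\<close>; \<open>w3\<close> uses
      \<open>w1\<close> and \<open>w2\<close> likewise.\<close>
    have w2: "D3 \<bullet> E2 s = - (d s / b s)" "D4 \<bullet> E2 s = 0"
      using fc[OF z(4) D(3) dy2] fc[OF z(5) D(4) dy2] b w1
      by (simp_all del: One_nat_def add: Y inner_simps o field_simps)
    have w3: "D4 \<bullet> E3 s = - ((E4 s \<bullet> vderiv 4 y s) / d s)"
      using fc[OF z(6) D(4) dy3] d w1 w2
      by (simp del: One_nat_def add: Y inner_simps o field_simps)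
    \<comment> \<open>Solving the curvature formulas for the diagonal gives b = v^2 k1 and d = v^3
      k1 k2, and the quotients of successive entries are the Frenet coefficients.\<close>
    have kv: "b s / v s = v s * k1 s" "d s / b s = v s * k2 s"
      "(E4 s \<bullet> vderiv 4 y s) / d s = v s * k3 s"
    proof -
      show "b s / v s = v s * k1 s" using v by (simp add: k1[OF s] power2_eq_square)
      show "d s / b s = v s * k2 s"
        using v b by (simp add: k2[OF s] k1[OF s] field_simps power2_eq_square power3_eq_cube)
      have "d s = v s ^ 3 * k1 s * k2 s" using v k1p by (simp add: k2[OF s])
      then show "(E4 s \<bullet> vderiv 4 y s) / d s = v s * k3 s"
        using v k1p k2p by (simp add: k3[OF s] field_simps power_numeral_reduce)
    qed
    note w = diag anti w1 w2 w3
    have "D1 = (norm (vderiv 1 y s) * k1 s) *\<^sub>R E2 s"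
      "D2 = norm (vderiv 1 y s) *\<^sub>R (- k1 s *\<^sub>R E1 s + k2 s *\<^sub>R E3 s)"
      "D3 = norm (vderiv 1 y s) *\<^sub>R (- k2 s *\<^sub>R E2 s + k3 s *\<^sub>R E4 s)"
      "D4 = - (norm (vderiv 1 y s) * k3 s) *\<^sub>R E3 s"
      unfolding nv
      by (rule orthonormal4_eqI[OF on[OF s]]; simp add: w inner_simps o kv)+
    with D show "(E1 has_vector_derivative (norm (vderiv 1 y s) * k1 s) *\<^sub>R E2 s) (at s)"
      "(E2 has_vector_derivative norm (vderiv 1 y s) *\<^sub>R (- k1 s *\<^sub>R E1 s + k2 s *\<^sub>R E3 s)) (at s)"
      "(E3 has_vector_derivative norm (vderiv 1 y s) *\<^sub>R (- k2 s *\<^sub>R E2 s + k3 s *\<^sub>R E4 s)) (at s)"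
      "(E4 has_vector_derivative - (norm (vderiv 1 y s) * k3 s) *\<^sub>R E3 s) (at s)"
      by blast+
  qed (use td reg in blast)+
qed

lemma frenet_frame4_unit_speed:
  assumes unit: "unit_speed_on I x" and fr: "frenet_frame4 I x V1 V2 V3 V4 k1 k2 k3" and s: "s \<in> I"
  shows "orthonormal4 (V1 s) (V2 s) (V3 s) (V4 s)"
    and "V1 s = vderiv 1 x s"
    and "k1 s = V2 s \<bullet> vderiv 2 x s" "k2 s = (V3 s \<bullet> vderiv 3 x s) / k1 s"
      "k3 s = (V4 s \<bullet> vderiv 4 x s) / (k1 s * k2 s)"
    and "(V1 has_vector_derivative k1 s *\<^sub>R V2 s) (at s)"
      "(V2 has_vector_derivative - k1 s *\<^sub>R V1 s + k2 s *\<^sub>R V3 s) (at s)"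
      "(V3 has_vector_derivative - k2 s *\<^sub>R V2 s + k3 s *\<^sub>R V4 s) (at s)"
      "(V4 has_vector_derivative - k3 s *\<^sub>R V3 s) (at s)"
proof -
  have v: "norm (vderiv 1 x s) = 1"
    using unit s by (simp add: unit_speed_on_def vderiv_def)
  note F = fr[unfolded frenet_frame4_def Let_def, THEN conjunct2, THEN conjunct2, THEN bspec, OF s,
      unfolded v sgn_div_norm power_one mult_1 div_by_1 inverse_1 scaleR_one]
  show "orthonormal4 (V1 s) (V2 s) (V3 s) (V4 s)"
    and "V1 s = vderiv 1 x s"
    and "k1 s = V2 s \<bullet> vderiv 2 x s" "k2 s = (V3 s \<bullet> vderiv 3 x s) / k1 s"
      "k3 s = (V4 s \<bullet> vderiv 4 x s) / (k1 s * k2 s)"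
    and "(V1 has_vector_derivative k1 s *\<^sub>R V2 s) (at s)"
      "(V2 has_vector_derivative - k1 s *\<^sub>R V1 s + k2 s *\<^sub>R V3 s) (at s)"
      "(V3 has_vector_derivative - k2 s *\<^sub>R V2 s + k3 s *\<^sub>R V4 s) (at s)"
      "(V4 has_vector_derivative - k3 s *\<^sub>R V3 s) (at s)"
    using F by blast+
qed

text \<open>Bootstrapping: if frame and curvatures are \<open>n\<close> times differentiable, the Frenet
  equations make the frame \<open>n + 1\<close> times differentiable, and the formulas for the
  curvatures then gain an order as well.\<close>

lemma frenet_frame4_smooth:
  assumes I: "open I" and x: "smooth_curve_on I x" and unit: "unit_speed_on I x"
    and fr: "frenet_frame4 I x V1 V2 V3 V4 k1 k2 k3"
    and nz: "\<And>s. s \<in> I \<Longrightarrow> k1 s \<noteq> 0 \<and> k2 s \<noteq> 0"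
  shows "smooth_curve_on I V1" "smooth_curve_on I V2" "smooth_curve_on I V3" "smooth_curve_on I V4"
    "smooth_curve_on I k1" "smooth_curve_on I k2" "smooth_curve_on I k3"
proof -
  note D = frenet_frame4_unit_speed(6-9)[OF unit fr]
  note k = frenet_frame4_unit_speed(3-5)[OF unit fr]
  have X: "times_differentiable_on m I (vderiv n x)" for m n
    using smooth_curve_on_vderiv[OF x] by (simp add: smooth_curve_on_def)
  have "times_differentiable_on n I V1 \<and> times_differentiable_on n I V2 \<and>
    times_differentiable_on n I V3 \<and> times_differentiable_on n I V4 \<and>
    times_differentiable_on n I k1 \<and> times_differentiable_on n I k2 \<and> times_differentiable_on n I k3" for n
  proof (induction n)
    case (Suc n)
    note td = times_differentiable_on_SucI[OF I]
    note intros = times_differentiable_on_add times_differentiable_on_minus times_differentiable_on_scaleR I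
    have V: "times_differentiable_on (Suc n) I V1" "times_differentiable_on (Suc n) I V2"
      "times_differentiable_on (Suc n) I V3" "times_differentiable_on (Suc n) I V4"
      by (rule td, erule D, intro intros; use Suc in simp)+
    \<comment> \<open>The derivatives of \<open>x\<close> are smooth, so the order gained by the
      frame passes to the curvatures. Each formula divides by the preceding curvatures, which fixes
      the order of the three steps.\<close>
    have 1: "times_differentiable_on (Suc n) I k1"
      by (rule times_differentiable_on_cong[OF I k(1)], assumption)
         (intro times_differentiable_on_inner I V X)
    have 2: "times_differentiable_on (Suc n) I k2"
      by (rule times_differentiable_on_cong[OF I k(2)], assumption)
         (intro times_differentiable_on_inner times_differentiable_on_divide I V X 1, simp add: nz)
    have 3: "times_differentiable_on (Suc n) I k3"
      by (rule times_differentiable_on_cong[OF I k(3)], assumption)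
         (intro times_differentiable_on_inner times_differentiable_on_divide
           times_differentiable_on_mult I V X 1 2, simp add: nz)
    from V 1 2 3 show ?case by blast
  qed simp
  then show "smooth_curve_on I V1" "smooth_curve_on I V2" "smooth_curve_on I V3" "smooth_curve_on I V4"
    "smooth_curve_on I k1" "smooth_curve_on I k2" "smooth_curve_on I k3"
    by (simp_all add: smooth_curve_on_def)
qed

text \<open>\<open>V2\<close> is the normalisation of a product of \<open>V3\<close>,
  \<open>V4\<close> and the velocity, so its inner product with that product is nonnegative. This
  number is the speed times the determinant of \<open>V3, V4, V1, V2\<close>, an even rearrangement
  of the frame, and nonnegativity excludes the value -1.\<close>

lemma frenet_frame4_positive:
  assumes fr: "frenet_frame4 I x V1 V2 V3 V4 k1 k2 k3" and s: "s \<in> I"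
  shows "cross4 (V1 s) (V2 s) (V3 s) \<bullet> V4 s = 1"
proof -
  note F = fr[unfolded frenet_frame4_def Let_def]
  have on: "orthonormal4 (V1 s) (V2 s) (V3 s) (V4 s)"
    and V1: "V1 s = sgn (vderiv 1 x s)" and V2: "V2 s = sgn (cross4 (V3 s) (V4 s) (vderiv 1 x s))"
    using F s by blast+
  define r where "r = norm (vderiv 1 x s)"
  have x1: "vderiv 1 x s = r *\<^sub>R V1 s"
    unfolding r_def V1 by (cases "vderiv 1 x s = 0") (simp_all add: sgn_div_norm del: One_nat_def)
  have "sgn u \<bullet> u = norm u" for u :: "real^4"
    by (cases "u = 0") (simp_all add: sgn_div_norm dot_square_norm power2_eq_square)
  then have "0 \<le> V2 s \<bullet> cross4 (V3 s) (V4 s) (vderiv 1 x s)"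
    by (metis V2 norm_ge_zero)
  also have "V2 s \<bullet> cross4 (V3 s) (V4 s) (vderiv 1 x s) = r * (cross4 (V3 s) (V4 s) (V1 s) \<bullet> V2 s)"
    by (simp only: x1 cross4_scaleR inner_scaleR_right inner_commute)
  also have "cross4 (V3 s) (V4 s) (V1 s) \<bullet> V2 s = cross4 (V1 s) (V2 s) (V3 s) \<bullet> V4 s"
    by (simp add: inner_vec_def sum_4 cross4_component algebra_simps)
  finally have "0 \<le> r * (cross4 (V1 s) (V2 s) (V3 s) \<bullet> V4 s)" .
  moreover have "0 < r"
  proof -
    have "V1 s \<noteq> 0" using on by (auto simp: orthonormal4_def)
    then show ?thesis using V1 by (auto simp: r_def sgn_zero_iff)
  qed
  ultimately show ?thesis
    using orthonormal4_det[OF on] by auto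
qed

subsection \<open>The involute of order two\<close>

text \<open>Here \<open>a, b, c, d\<close> stand for the frame of \<open>x\<close>, and
  \<open>e, p, q, A\<close> for the sign of \<phi>, \<kappa>2, \<kappa>3 and \<kappa>2 N - \<kappa>3
  L. \<open>E3\<close> comes from Gram-Schmidt: the part of the third derivative orthogonal to
  \<open>E1\<close> and \<open>E2\<close> is K a + (A / r^2) (q b + p d), of length W / r, which is
  the origin of \<open>W\<close>. Prescribing \<open>r\<close> and \<open>W\<close> by their squares
  keeps all checks free of roots.\<close>

lemma involute_frame:
  fixes a b c d :: "real^4" and e p q r A K W :: real
  assumes on: "orthonormal4 a b c d" and pos: "cross4 a b c \<bullet> d = 1"
    and e: "e * e = 1" and r: "0 < r" "r * r = p\<^sup>2 + q\<^sup>2" and W: "0 < W" "W * W = K\<^sup>2 * (p\<^sup>2 + q\<^sup>2) + A\<^sup>2"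
  defines "E1 \<equiv> e *\<^sub>R c" and "E2 \<equiv> (e / r) *\<^sub>R (- p *\<^sub>R b + q *\<^sub>R d)"
    and "E3 \<equiv> (1 / (W * r)) *\<^sub>R ((K * (p\<^sup>2 + q\<^sup>2)) *\<^sub>R a + (A * q) *\<^sub>R b + (A * p) *\<^sub>R d)"
    and "E4 \<equiv> (1 / W) *\<^sub>R (- A *\<^sub>R a + (q * K) *\<^sub>R b + (p * K) *\<^sub>R d)"
  shows "orthonormal4 E1 E2 E3 E4" and "cross4 E1 E2 E3 \<bullet> E4 = 1"
proof -
  note o = orthonormal4_inner[OF on]
  show on': "orthonormal4 E1 E2 E3 E4"
  proof (rule orthonormal4I)
    show "E1 \<bullet> E1 = 1" using e by (simp add: E1_def o)
    have "E2 \<bullet> E2 = (e * e) * (p\<^sup>2 + q\<^sup>2) / (r * r)"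
      by (simp add: E2_def inner_simps o power2_eq_square add_divide_distrib algebra_simps)
    moreover have "p\<^sup>2 + q\<^sup>2 \<noteq> 0" using r by (metis less_irrefl mult_pos_pos)
    ultimately show "E2 \<bullet> E2 = 1" using e r(2) by simp
    have "E3 \<bullet> E3 = (p\<^sup>2 + q\<^sup>2) * (K\<^sup>2 * (p\<^sup>2 + q\<^sup>2) + A\<^sup>2) / ((W * W) * (r * r))"
      by (simp add: E3_def inner_simps o power2_eq_square add_divide_distrib algebra_simps)
    then have "E3 \<bullet> E3 = (r * r) * (W * W) / ((W * W) * (r * r))"
      by (simp only: r(2) W(2))
    then show "E3 \<bullet> E3 = 1" using r(1) W(1) by simp
    have "E4 \<bullet> E4 = (K\<^sup>2 * (p\<^sup>2 + q\<^sup>2) + A\<^sup>2) / (W * W)"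
      by (simp add: E4_def inner_simps o power2_eq_square add_divide_distrib algebra_simps)
    then have "E4 \<bullet> E4 = (W * W) / (W * W)"
      by (simp only: W(2))
    then show "E4 \<bullet> E4 = 1" using W(1) by simp
    show "E1 \<bullet> E2 = 0" "E1 \<bullet> E3 = 0" "E1 \<bullet> E4 = 0" "E2 \<bullet> E3 = 0" "E2 \<bullet> E4 = 0" "E3 \<bullet> E4 = 0"
      by (simp_all add: E1_def E2_def E3_def E4_def inner_simps o power2_eq_square algebra_simps)
  qed
  have c: "cross4 c b a = - d" "cross4 c b d = a" "cross4 c d a = b" "cross4 c d b = - a"
    using cross4_frame[OF on pos] by (metis cross4_swap12 cross4_swap23 add.inverse_inverse)+
  \<comment> \<open>The scalar is 1; it is kept unevaluated so that the coordinates agree without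
    using the equations for \<open>e\<close> and \<open>r\<close>.\<close>
  have "cross4 E1 E2 E3 = ((e * e) / (r * r) * (p\<^sup>2 + q\<^sup>2)) *\<^sub>R E4"
    unfolding E1_def E2_def E3_def E4_def
    by (rule orthonormal4_eqI[OF on];
        unfold cross4_add cross4_scaleR cross4_repeat c inner_add_left inner_scaleR_left inner_minus_left o;
        simp add: power2_eq_square add_divide_distrib algebra_simps)
  also have "\<dots> = E4" unfolding e r(2)[symmetric] using r(1) by simp
  finally show "cross4 E1 E2 E3 \<bullet> E4 = 1"
    using orthonormal4_inner(4)[OF on'] by simp
qed

theorem proposition11:
  fixes I :: "real set"
    and x xb V1 V2 V3 V4 :: "real \<Rightarrow> real^4"
    and \<kappa>1 \<kappa>2 \<kappa>3 l1 l2 :: "real \<Rightarrow> real"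
    and \<phi> K L N W \<kappa>1b \<kappa>2b \<kappa>3b :: "real \<Rightarrow> real"
    and V1b V2b V3b V4b :: "real \<Rightarrow> real^4"
  assumes "open I" and "is_interval I" and "I \<noteq> {}"
    and "smooth_curve_on I x" and "unit_speed_on I x"
    and "frenet_frame4 I x V1 V2 V3 V4 \<kappa>1 \<kappa>2 \<kappa>3"
    and "\<And>s. s \<in> I \<Longrightarrow> \<kappa>1 s \<noteq> 0 \<and> \<kappa>2 s \<noteq> 0 \<and> \<kappa>3 s \<noteq> 0"
    and "involute2 I x V1 V2 l1 l2 xb" and "regular_on I xb"
    and "\<phi> = (\<lambda>s. l2 s * \<kappa>2 s)"
    and "K = (\<lambda>s. \<kappa>1 s * \<kappa>2 s * \<phi> s)"
    and "L = (\<lambda>s. 2 * \<kappa>2 s * deriv \<phi> s + deriv \<kappa>2 s * \<phi> s)"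
    and "N = (\<lambda>s. 2 * \<kappa>3 s * deriv \<phi> s + deriv \<kappa>3 s * \<phi> s)"
    and "W = (\<lambda>s. sqrt ((K s)\<^sup>2 * ((\<kappa>2 s)\<^sup>2 + (\<kappa>3 s)\<^sup>2) + (\<kappa>2 s * N s - \<kappa>3 s * L s)\<^sup>2))"
    and "V1b = (\<lambda>s. sgn (\<phi> s) *\<^sub>R V3 s)"
    and "V2b = (\<lambda>s. (sgn (\<phi> s) / sqrt ((\<kappa>2 s)\<^sup>2 + (\<kappa>3 s)\<^sup>2)) *\<^sub>R (- \<kappa>2 s *\<^sub>R V2 s + \<kappa>3 s *\<^sub>R V4 s))"
    and "V3b = (\<lambda>s. (1 / (W s * sqrt ((\<kappa>2 s)\<^sup>2 + (\<kappa>3 s)\<^sup>2))) *\<^sub>R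
           ((K s * ((\<kappa>2 s)\<^sup>2 + (\<kappa>3 s)\<^sup>2)) *\<^sub>R V1 s
            + ((\<kappa>2 s * N s - \<kappa>3 s * L s) * \<kappa>3 s) *\<^sub>R V2 s
            + ((\<kappa>2 s * N s - \<kappa>3 s * L s) * \<kappa>2 s) *\<^sub>R V4 s))"
    and "V4b = (\<lambda>s. (1 / W s) *\<^sub>R
           (- (\<kappa>2 s * N s - \<kappa>3 s * L s) *\<^sub>R V1 s + (\<kappa>3 s * K s) *\<^sub>R V2 s + (\<kappa>2 s * K s) *\<^sub>R V4 s))"
    and "\<kappa>1b = (\<lambda>s. sqrt ((\<kappa>2 s)\<^sup>2 + (\<kappa>3 s)\<^sup>2) / \<bar>\<phi> s\<bar>)"
    and "\<kappa>2b = (\<lambda>s. W s / ((\<phi> s)\<^sup>2 * ((\<kappa>2 s)\<^sup>2 + (\<kappa>3 s)\<^sup>2)))"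
    and "\<kappa>3b = (\<lambda>s. (- (\<kappa>2 s * N s - \<kappa>3 s * L s) * (\<kappa>1 s * L s + deriv K s)
                     + (\<kappa>2 s * deriv N s - \<kappa>3 s * deriv L s) * K s + \<kappa>1 s * \<kappa>3 s * (K s)\<^sup>2)
                    / (W s * (\<phi> s) ^ 4 * \<kappa>1b s * \<kappa>2b s))"
  shows "frenet_frame4 I xb V1b V2b V3b V4b \<kappa>1b \<kappa>2b \<kappa>3b \<and>
    (\<forall>s\<in>I. W s = \<bar>\<phi> s\<bar> * sqrt ((\<kappa>1 s)\<^sup>2 * (\<kappa>2 s)\<^sup>2 * ((\<kappa>2 s)\<^sup>2 + (\<kappa>3 s)\<^sup>2)
                                   + (\<kappa>2 s * deriv \<kappa>3 s - \<kappa>3 s * deriv \<kappa>2 s)\<^sup>2))"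
proof -
  note I = assms(1) and x = assms(4) and unit = assms(5) and fr = assms(6)
    and \<phi> = assms(10) and K = assms(11) and L = assms(12) and N = assms(13) and W = assms(14)
    and V1b = assms(15) and V2b = assms(16) and V3b = assms(17) and V4b = assms(18)
    and \<kappa>1b = assms(19) and \<kappa>2b = assms(20) and \<kappa>3b = assms(21)
  have nz: "\<kappa>1 s \<noteq> 0" "\<kappa>2 s \<noteq> 0" "\<kappa>3 s \<noteq> 0" if "s \<in> I" for s
    using assms(7)[OF that] by auto
  have xb: "xb = (\<lambda>s. x s + l1 s *\<^sub>R V1 s + l2 s *\<^sub>R V2 s)"
    using assms(8) unfolding involute2_def by blast
  have inv: "l1 differentiable (at s)" "l2 differentiable (at s)"
      "vector_derivative xb (at s) \<bullet> V1 s = 0" "vector_derivative xb (at s) \<bullet> V2 s = 0" if "s \<in> I" for s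
    using assms(8) that unfolding involute2_def by blast+
  note on = frenet_frame4_unit_speed(1)[OF unit fr]
  note D = frenet_frame4_unit_speed(6-9)[OF unit fr]
  have "\<kappa>1 s \<noteq> 0 \<and> \<kappa>2 s \<noteq> 0" if "s \<in> I" for s
    using nz[OF that] by simp
  note smV = frenet_frame4_smooth[OF I x unit fr this]

  have xb': "(xb has_vector_derivative \<phi> s *\<^sub>R V3 s) (at s)"
    and l1': "(l1 has_real_derivative \<kappa>1 s * l2 s - 1) (at s)"
    and l2': "(l2 has_real_derivative - (\<kappa>1 s * l1 s)) (at s)" if s: "s \<in> I" for s
  proof -
    note o = orthonormal4_inner[OF on[OF s]]
    obtain d1 d2 where d1: "(l1 has_real_derivative d1) (at s)" and d2: "(l2 has_real_derivative d2) (at s)"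
      using inv(1,2)[OF s] by (auto simp: real_differentiable_def)
    have x1: "(x has_vector_derivative V1 s) (at s)"
      using times_differentiable_on_has_vderiv[of 0 I x s] x s
        frenet_frame4_unit_speed(2)[OF unit fr s] by (simp add: smooth_curve_on_def)
    have *: "(xb has_vector_derivative (V1 s + (l1 s *\<^sub>R (\<kappa>1 s *\<^sub>R V2 s) + d1 *\<^sub>R V1 s)
        + (l2 s *\<^sub>R (- \<kappa>1 s *\<^sub>R V1 s + \<kappa>2 s *\<^sub>R V3 s) + d2 *\<^sub>R V2 s))) (at s)"
      unfolding xb
      by (intro has_vector_derivative_add has_vector_derivative_scaleR x1 d1 d2 D[OF s])
    \<comment> \<open>The orthogonality conditions say that the \<open>V1\<close> and
      \<open>V2\<close> coordinates of this derivative vanish: l1' + 1 - \<kappa>1 l2 = 0 and l2' +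
      \<kappa>1 l1 = 0. What survives is l2 \<kappa>2 V3.\<close>
    note vd = vector_derivative_at[OF *]
    have e: "d1 = \<kappa>1 s * l2 s - 1" "d2 = - (\<kappa>1 s * l1 s)"
      using inv(3,4)[OF s] unfolding vd by (simp_all add: inner_simps o algebra_simps)
    show "(l1 has_real_derivative \<kappa>1 s * l2 s - 1) (at s)"
      and "(l2 has_real_derivative - (\<kappa>1 s * l1 s)) (at s)"
      using d1 d2 e by simp_all
    show "(xb has_vector_derivative \<phi> s *\<^sub>R V3 s) (at s)"
      using * by (simp add: e \<phi> algebra_simps)
  qed

  \<comment> \<open>The linear system for \<open>l1\<close>, \<open>l2\<close> has smooth
    coefficients, so every order of differentiability yields the next.\<close>
  have "times_differentiable_on n I l1 \<and> times_differentiable_on n I l2" for n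
  proof (induction n)
    case (Suc n)
    have "times_differentiable_on n I \<kappa>1" using smV(5) by (simp add: smooth_curve_on_def)
    with Suc have 1: "times_differentiable_on n I (\<lambda>s. \<kappa>1 s * l2 s - 1)"
      and 2: "times_differentiable_on n I (\<lambda>s. - (\<kappa>1 s * l1 s))"
      by (auto intro!: times_differentiable_on_diff times_differentiable_on_minus
          times_differentiable_on_mult times_differentiable_on_const I)
    show ?case
      using times_differentiable_on_SucI[OF I l1'[unfolded has_real_derivative_iff_has_vector_derivative] 1]
        times_differentiable_on_SucI[OF I l2'[unfolded has_real_derivative_iff_has_vector_derivative] 2]
      by blast
  qed simp
  then have sml2: "smooth_curve_on I l2" by (simp add: smooth_curve_on_def)
  note sm = smooth_curve_on_mult smooth_curve_on_add smooth_curve_on_diff smooth_curve_on_const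
    smooth_curve_on_deriv I smV
  have sm\<phi>: "smooth_curve_on I \<phi>" unfolding \<phi> by (intro sm sml2)
  have smK: "smooth_curve_on I K" unfolding K by (intro sm sm\<phi>)
  have smL: "smooth_curve_on I L" unfolding L by (intro sm sm\<phi>)
  have smN: "smooth_curve_on I N" unfolding N by (intro sm sm\<phi>)
  \<comment> \<open>\<open>M\<close> will be the \<open>V3\<close> coordinate of the third
    derivative. Products in place of squares let the closure rules in \<open>sm\<close>
    apply.\<close>
  define S where "S = (\<lambda>s. \<kappa>2 s * \<kappa>2 s + \<kappa>3 s * \<kappa>3 s)"
  define M where "M = (\<lambda>s. deriv (deriv \<phi>) s - \<phi> s * S s)"
  have smM: "smooth_curve_on I M" unfolding M_def S_def by (intro sm sm\<phi>)
  have td: "times_differentiable_on 4 I xb"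
  proof -
    have "smooth_curve_on I (\<lambda>s. \<phi> s *\<^sub>R V3 s)"
      by (intro smooth_curve_on_scaleR I sm\<phi> smV)
    then have "times_differentiable_on (Suc 3) I xb"
      by (intro times_differentiable_on_SucI[OF I xb']) (simp_all add: smooth_curve_on_def)
    then show ?thesis by simp
  qed
  have \<phi>nz: "\<phi> s \<noteq> 0" if "s \<in> I" for s
    using assms(9) vector_derivative_at[OF xb'[OF that]] that by (auto simp: regular_on_def)

  \<comment> \<open>Derivatives of the involute up to order four\<close>
  note dR = smooth_curve_on_DERIV
  note der = has_vector_derivative_add has_vector_derivative_scaleR D DERIV_mult' DERIV_minus
    dR[OF sm\<phi>] dR[OF smV(5)] dR[OF smV(6)] dR[OF smV(7)] dR[OF smK] dR[OF smL] dR[OF smN] dR[OF smM]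
    dR[OF smooth_curve_on_deriv[OF I sm\<phi>]]
  have y1: "vderiv 1 xb s = \<phi> s *\<^sub>R V3 s" if "s \<in> I" for s
    using vector_derivative_at[OF xb'[OF that]] by (simp add: vderiv_def)
  have y2: "vderiv 2 xb s = deriv \<phi> s *\<^sub>R V3 s + (- (\<phi> s * \<kappa>2 s)) *\<^sub>R V2 s + (\<phi> s * \<kappa>3 s) *\<^sub>R V4 s"
    if s: "s \<in> I" for s
  proof -
    have "((\<lambda>s. \<phi> s *\<^sub>R V3 s) has_vector_derivative
        \<phi> s *\<^sub>R (- \<kappa>2 s *\<^sub>R V2 s + \<kappa>3 s *\<^sub>R V4 s) + deriv \<phi> s *\<^sub>R V3 s) (at s)"
      by (intro der s)
    from vderiv_SucI[OF I y1 s this] show ?thesis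
      by (simp add: numeral_2_eq_2 algebra_simps)
  qed
  \<comment> \<open>The factor 2 in \<open>L\<close> and \<open>N\<close> has two sources:
    differentiating \<open>V3\<close> in the tangential term, and differentiating \<phi> in the
    coefficients of \<open>V2\<close> and \<open>V4\<close>.\<close>
  have y3: "vderiv 3 xb s = K s *\<^sub>R V1 s + (- L s) *\<^sub>R V2 s + M s *\<^sub>R V3 s + N s *\<^sub>R V4 s"
    if s: "s \<in> I" for s
  proof -
    have "((\<lambda>s. deriv \<phi> s *\<^sub>R V3 s + (- (\<phi> s * \<kappa>2 s)) *\<^sub>R V2 s + (\<phi> s * \<kappa>3 s) *\<^sub>R V4 s) has_vector_derivative
        deriv \<phi> s *\<^sub>R (- \<kappa>2 s *\<^sub>R V2 s + \<kappa>3 s *\<^sub>R V4 s) + deriv (deriv \<phi>) s *\<^sub>R V3 s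
        + ((- (\<phi> s * \<kappa>2 s)) *\<^sub>R (- \<kappa>1 s *\<^sub>R V1 s + \<kappa>2 s *\<^sub>R V3 s)
          + (- (\<phi> s * deriv \<kappa>2 s + deriv \<phi> s * \<kappa>2 s)) *\<^sub>R V2 s)
        + ((\<phi> s * \<kappa>3 s) *\<^sub>R (- \<kappa>3 s *\<^sub>R V3 s)
          + (\<phi> s * deriv \<kappa>3 s + deriv \<phi> s * \<kappa>3 s) *\<^sub>R V4 s)) (at s)"
      (is "(_ has_vector_derivative ?D) _")
      by (intro der s)
    from vderiv_SucI[OF I y2 s this] have eq: "vderiv 3 xb s = ?D" by simp
    show ?thesis
      by (rule orthonormal4_eqI[OF on[OF s]];
          unfold eq inner_add_left inner_scaleR_left orthonormal4_inner[OF on[OF s]];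
          simp add: K L N M_def S_def algebra_simps)
  qed
  have y4: "vderiv 4 xb s = (deriv K s + \<kappa>1 s * L s) *\<^sub>R V1 s + (\<kappa>1 s * K s - deriv L s - \<kappa>2 s * M s) *\<^sub>R V2 s
      + (deriv M s - \<kappa>2 s * L s - \<kappa>3 s * N s) *\<^sub>R V3 s + (deriv N s + \<kappa>3 s * M s) *\<^sub>R V4 s"
    if s: "s \<in> I" for s
  proof -
    have "((\<lambda>s. K s *\<^sub>R V1 s + (- L s) *\<^sub>R V2 s + M s *\<^sub>R V3 s + N s *\<^sub>R V4 s) has_vector_derivative
        K s *\<^sub>R (\<kappa>1 s *\<^sub>R V2 s) + deriv K s *\<^sub>R V1 s
        + ((- L s) *\<^sub>R (- \<kappa>1 s *\<^sub>R V1 s + \<kappa>2 s *\<^sub>R V3 s) + (- deriv L s) *\<^sub>R V2 s)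
        + (M s *\<^sub>R (- \<kappa>2 s *\<^sub>R V2 s + \<kappa>3 s *\<^sub>R V4 s) + deriv M s *\<^sub>R V3 s)
        + (N s *\<^sub>R (- \<kappa>3 s *\<^sub>R V3 s) + deriv N s *\<^sub>R V4 s)) (at s)"
      (is "(_ has_vector_derivative ?D) _")
      by (intro der s)
    from vderiv_SucI[OF I y3 s this] have eq: "vderiv 4 xb s = ?D" by simp
    show ?thesis
      by (rule orthonormal4_eqI[OF on[OF s]];
          unfold eq inner_add_left inner_scaleR_left orthonormal4_inner[OF on[OF s]];
          simp add: algebra_simps)
  qed

  \<comment> \<open>The claimed frame and its orientation\<close>
  define A where "A = (\<lambda>s. \<kappa>2 s * N s - \<kappa>3 s * L s)"
  define r where "r = (\<lambda>s. sqrt ((\<kappa>2 s)\<^sup>2 + (\<kappa>3 s)\<^sup>2))"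
  \<comment> \<open>The terms 2 \<kappa>2 \<kappa>3 \<phi>' cancel, so \<phi> factors out. This is
    what produces the second form of \<open>W\<close>.\<close>
  have A\<phi>: "A s = \<phi> s * (\<kappa>2 s * deriv \<kappa>3 s - \<kappa>3 s * deriv \<kappa>2 s)" for s
    by (simp add: A_def L N algebra_simps)
  have Spos: "0 < (\<kappa>2 s)\<^sup>2 + (\<kappa>3 s)\<^sup>2" if "s \<in> I" for s
    using nz[OF that] by (simp add: sum_power2_gt_zero_iff)
  have r: "0 < r s" "r s * r s = (\<kappa>2 s)\<^sup>2 + (\<kappa>3 s)\<^sup>2" if "s \<in> I" for s
    using Spos[OF that] by (simp_all add: r_def)
  \<comment> \<open>\<open>A\<close> may vanish, so the positivity of \<open>W\<close> rests on
    \<open>K\<close>.\<close>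
  have Knz: "K s \<noteq> 0" if "s \<in> I" for s
    using nz[OF that] \<phi>nz[OF that] by (simp add: K)
  have Wpos: "0 < (K s)\<^sup>2 * ((\<kappa>2 s)\<^sup>2 + (\<kappa>3 s)\<^sup>2) + (A s)\<^sup>2" if "s \<in> I" for s
    using Knz[OF that] by (intro add_pos_nonneg mult_pos_pos Spos[OF that]) auto
  have WA: "W = (\<lambda>s. sqrt ((K s)\<^sup>2 * ((\<kappa>2 s)\<^sup>2 + (\<kappa>3 s)\<^sup>2) + (A s)\<^sup>2))"
    unfolding W A_def ..
  have Wp: "0 < W s" "W s * W s = (K s)\<^sup>2 * ((\<kappa>2 s)\<^sup>2 + (\<kappa>3 s)\<^sup>2) + (A s)\<^sup>2" if "s \<in> I" for s
    using Wpos[OF that] by (simp_all add: WA)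
  have V2b': "V2b s = (sgn (\<phi> s) / r s) *\<^sub>R (- \<kappa>2 s *\<^sub>R V2 s + \<kappa>3 s *\<^sub>R V4 s)"
    and V3b': "V3b s = (1 / (W s * r s)) *\<^sub>R ((K s * ((\<kappa>2 s)\<^sup>2 + (\<kappa>3 s)\<^sup>2)) *\<^sub>R V1 s
      + (A s * \<kappa>3 s) *\<^sub>R V2 s + (A s * \<kappa>2 s) *\<^sub>R V4 s)"
    and V4b': "V4b s = (1 / W s) *\<^sub>R (- A s *\<^sub>R V1 s + (\<kappa>3 s * K s) *\<^sub>R V2 s + (\<kappa>2 s * K s) *\<^sub>R V4 s)" for s
    by (simp_all add: V2b V3b V4b r_def A_def)
  have e: "sgn (\<phi> s) * sgn (\<phi> s) = 1" "\<phi> s = sgn (\<phi> s) * \<bar>\<phi> s\<bar>" "\<bar>\<phi> s\<bar> = sgn (\<phi> s) * \<phi> s" if "s \<in> I" for s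
    using \<phi>nz[OF that] by (auto simp: sgn_real_def)
  have frame: "orthonormal4 (V1b s) (V2b s) (V3b s) (V4b s)"
      "cross4 (V1b s) (V2b s) (V3b s) \<bullet> V4b s = 1" if "s \<in> I" for s
    unfolding V1b V2b' V3b' V4b'
    using involute_frame[OF on[OF that] frenet_frame4_positive[OF fr that] e(1) r Wp] that by blast+

  have "frenet_frame4 I xb V1b V2b V3b V4b \<kappa>1b \<kappa>2b \<kappa>3b"
  proof (rule frenet_frame4I[OF I td])
    fix s assume s: "s \<in> I"
    note o = orthonormal4_inner[OF on[OF s]]
    note pos = r[OF s] Wp[OF s] \<phi>nz[OF s]
    show "V1b differentiable (at s) \<and> V2b differentiable (at s) \<and> V3b differentiable (at s) \<and> V4b differentiable (at s)"
    proof -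
      have d: "f differentiable (at s)" if "smooth_curve_on I f" for f :: "real \<Rightarrow> 'b::real_normed_vector"
        using that s by (rule smooth_curve_on_differentiable)
      have smA: "smooth_curve_on I A" unfolding A_def by (intro sm smN smL)
      have rd: "(\<lambda>s. sqrt ((\<kappa>2 s)\<^sup>2 + (\<kappa>3 s)\<^sup>2)) differentiable (at s)"
        using Spos[OF s]
        by (intro differentiable_real_sqrt differentiable_add differentiable_power d smV)
      have Wd: "W differentiable (at s)"
        unfolding WA using Wpos[OF s]
        by (intro differentiable_real_sqrt differentiable_add differentiable_mult differentiable_power d smV smK smA)
      have "W s \<noteq> 0" "sqrt ((\<kappa>2 s)\<^sup>2 + (\<kappa>3 s)\<^sup>2) \<noteq> 0" "W s * sqrt ((\<kappa>2 s)\<^sup>2 + (\<kappa>3 s)\<^sup>2) \<noteq> 0"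
        using Wp(1)[OF s] Spos[OF s] by auto
      then show ?thesis
        unfolding V1b V2b V3b V4b
        by (intro conjI differentiable_scaleR differentiable_divide differentiable_const sgn_differentiable
            rd Wd differentiable_add differentiable_minus differentiable_mult differentiable_diff
            differentiable_power \<phi>nz[OF s] d smV smK smL smN sm\<phi>)
    qed
    show "orthonormal4 (V1b s) (V2b s) (V3b s) (V4b s)" "cross4 (V1b s) (V2b s) (V3b s) \<bullet> V4b s = 1"
      using frame[OF s] .
    \<comment> \<open>The diagonal of the triangular expansion is \<bar>\<phi>\<bar>,
      \<bar>\<phi>\<bar> r, W / r. Moving the sign of \<phi> into the frame vectors is what makes it
      positive.\<close>
    show "vderiv 1 xb s = \<bar>\<phi> s\<bar> *\<^sub>R V1b s"
      using e(2)[OF s] by (simp add: y1[OF s] V1b mult.commute del: One_nat_def)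
    show "vderiv 2 xb s = (sgn (\<phi> s) * deriv \<phi> s) *\<^sub>R V1b s + (\<bar>\<phi> s\<bar> * r s) *\<^sub>R V2b s"
    proof -
      have "(\<bar>\<phi> s\<bar> * r s) * (sgn (\<phi> s) / r s) = \<phi> s"
        using pos e(2)[OF s] by (simp add: field_simps)
      moreover have "sgn (\<phi> s) * deriv \<phi> s * sgn (\<phi> s) = deriv \<phi> s"
        using e(1)[OF s] by (simp add: mult.left_commute mult.commute)
      ultimately show ?thesis
        unfolding y2[OF s] V1b V2b' scaleR_scaleR by (simp add: algebra_simps)
    qed
    show "vderiv 3 xb s = (sgn (\<phi> s) * M s) *\<^sub>R V1b s
        + (sgn (\<phi> s) * (\<kappa>2 s * L s + \<kappa>3 s * N s) / r s) *\<^sub>R V2b s + (W s / r s) *\<^sub>R V3b s"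
    proof -
      define Q where "Q = (\<kappa>2 s)\<^sup>2 + (\<kappa>3 s)\<^sup>2"
      have Q: "Q \<noteq> 0" unfolding Q_def using Spos[OF s] by (rule less_imp_neq[symmetric])
      \<comment> \<open>This resolves - L V2 + N V4 along the orthogonal directions - \<kappa>2 V2 +
        \<kappa>3 V4 and \<kappa>3 V2 + \<kappa>2 V4, both of squared length
        \<open>Q\<close>.\<close>
      have LQ: "L s * Q = \<kappa>2 s * (\<kappa>2 s * L s + \<kappa>3 s * N s) - A s * \<kappa>3 s"
        and NQ: "N s * Q = \<kappa>3 s * (\<kappa>2 s * L s + \<kappa>3 s * N s) + A s * \<kappa>2 s"
        by (simp_all add: Q_def A_def power2_eq_square algebra_simps)
      have 1: "sgn (\<phi> s) * M s * sgn (\<phi> s) = M s"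
        using e(1)[OF s] by (simp add: mult.left_commute mult.commute)
      have "(sgn (\<phi> s) * (\<kappa>2 s * L s + \<kappa>3 s * N s) / r s) * (sgn (\<phi> s) / r s) =
          (sgn (\<phi> s) * sgn (\<phi> s)) * (\<kappa>2 s * L s + \<kappa>3 s * N s) / (r s * r s)"
        by simp
      also have "\<dots> = (\<kappa>2 s * L s + \<kappa>3 s * N s) / ((\<kappa>2 s)\<^sup>2 + (\<kappa>3 s)\<^sup>2)"
        unfolding r(2)[OF s] e(1)[OF s] by simp
      finally have 2: "(sgn (\<phi> s) * (\<kappa>2 s * L s + \<kappa>3 s * N s) / r s) * (sgn (\<phi> s) / r s) = \<dots>" .
      have "(W s / r s) * (1 / (W s * r s)) = 1 / (r s * r s)"
        using pos by simp
      then have 3: "(W s / r s) * (1 / (W s * r s)) = 1 / ((\<kappa>2 s)\<^sup>2 + (\<kappa>3 s)\<^sup>2)"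
        unfolding r(2)[OF s] .
      show ?thesis
        unfolding y3[OF s] V1b V2b' V3b' scaleR_scaleR 1 2 3 Q_def[symmetric]
        by (rule orthonormal4_eqI[OF on[OF s]]; unfold inner_add_left inner_scaleR_left o;
            use Q LQ NQ in \<open>simp add: field_simps\<close>)
    qed
    show "0 < \<bar>\<phi> s\<bar> \<and> 0 < \<bar>\<phi> s\<bar> * r s \<and> 0 < W s / r s"
      using pos by simp
    have k: "\<kappa>1b s = r s / \<bar>\<phi> s\<bar>" by (simp add: \<kappa>1b r_def)
    show "\<kappa>1b s = \<bar>\<phi> s\<bar> * r s / \<bar>\<phi> s\<bar>\<^sup>2"
      unfolding k power2_eq_square using \<phi>nz[OF s] by (simp del: abs_mult_self_eq)
    show "\<kappa>2b s = (W s / r s) / (\<bar>\<phi> s\<bar> ^ 3 * \<kappa>1b s)"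
    proof -
      \<comment> \<open>Together with the \<open>r\<close> in W / r this leaves r^2 = \<kappa>2^2 +
        \<kappa>3^2 in the denominator.\<close>
      have "\<bar>\<phi> s\<bar> ^ 3 * \<kappa>1b s = (\<phi> s)\<^sup>2 * r s"
        unfolding k using \<phi>nz[OF s] by (simp add: power3_eq_cube power2_eq_square)
      then show ?thesis
        by (simp add: \<kappa>2b mult.assoc flip: r(2)[OF s])
    qed
    \<comment> \<open>\<open>M\<close> drops out because \<open>V4b\<close> is orthogonal to -
      \<kappa>2 V2 + \<kappa>3 V4, and its derivative because \<open>V4b\<close> has no
      \<open>V3\<close> coordinate.\<close>
    have "V4b s \<bullet> vderiv 4 xb s = (- A s * (\<kappa>1 s * L s + deriv K s)
        + (\<kappa>2 s * deriv N s - \<kappa>3 s * deriv L s) * K s + \<kappa>1 s * \<kappa>3 s * (K s)\<^sup>2) / W s"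
      unfolding V4b' y4[OF s]
      by (simp add: inner_simps o power2_eq_square add_divide_distrib diff_divide_distrib algebra_simps)
    then show "\<kappa>3b s = (V4b s \<bullet> vderiv 4 xb s) / (\<bar>\<phi> s\<bar> ^ 4 * \<kappa>1b s * \<kappa>2b s)"
      by (simp add: \<kappa>3b A_def mult.assoc)
  qed
  moreover have "W s = \<bar>\<phi> s\<bar> * sqrt ((\<kappa>1 s)\<^sup>2 * (\<kappa>2 s)\<^sup>2 * ((\<kappa>2 s)\<^sup>2 + (\<kappa>3 s)\<^sup>2)
      + (\<kappa>2 s * deriv \<kappa>3 s - \<kappa>3 s * deriv \<kappa>2 s)\<^sup>2)" for s
  proof -
    have "(K s)\<^sup>2 * ((\<kappa>2 s)\<^sup>2 + (\<kappa>3 s)\<^sup>2) + (A s)\<^sup>2 = (\<phi> s)\<^sup>2 * ((\<kappa>1 s)\<^sup>2 * (\<kappa>2 s)\<^sup>2 * ((\<kappa>2 s)\<^sup>2 + (\<kappa>3 s)\<^sup>2)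
      + (\<kappa>2 s * deriv \<kappa>3 s - \<kappa>3 s * deriv \<kappa>2 s)\<^sup>2)"
      by (simp only: K A\<phi> power_mult_distrib distrib_left mult_ac)
    then show ?thesis
      by (simp add: WA real_sqrt_mult)
  qed
  ultimately show ?thesis by blast
qed

end
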